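(* Let $\alpha=(\alpha_1,\dots,\alpha_n)$ and $\beta=(\beta_{n+1},\dots,\beta_{n+m})$ be nonzero vectors, $\xi(x_1,\dots,x_n)=\sum_{i=1}^n\alpha_ix_i$ on $\mathbb{R}^n$ and $\zeta(x_{n+1},\dots,x_{n+m})=\sum_{j=n+1}^{n+m}\beta_jx_j$ on $\mathbb{R}^m$. Let $\varphi>0$, $f>0$, $h$ be smooth functions on $\mathbb{R}^n$ of the form $\varphi\circ\xi$, $f\circ\xi$, $h\circ\xi$, and $\tau>0$, $u$ smooth functions on $\mathbb{R}^m$ of the form $\tau\circ\zeta$, $u\circ\zeta$, with $u$ non-constant. Let $\lambda\in\mathbb{R}$, $\theta\ge0$. Consider $\mathbb{R}^n\times\mathbb{R}^m$ with the warped product metric $g=\varphi^{-2}g_0+f^2\tau^{-2}g_0$ (base $(\mathbb{R}^n,\varphi^{-2}g_0)$, fiber $(\mathbb{R}^m,\tau^{-2}g_0)$, warping function $f$), regarding $h$ and $u$ as functions on the product through the projections $\pi$ to $\mathbb{R}^n$ and $\sigma$ to $\mathbb{R}^m$, respectively. Then $(\mathbb{R}^n\times_f\mathbb{R}^m,g,h,u,\lambda)$ is a GRHS (with constant $\theta$) if and only if the following equations hold: $$(n-2)\frac{\varphi''}{\varphi}-m\frac{f''}{f}-2m\frac{\varphi'}{\varphi}\frac{f'}{f}+h''+2\frac{\varphi'}{\varphi}h'=0,$$ $$\left[\frac{\varphi''}{\varphi}-(n-1)\left(\frac{\varphi'}{\varphi}\right)^2+m\frac{\varphi'}{\varphi}\frac{f'}{f}-\frac{\varphi'}{\varphi}h'\right]\|\alpha\|^2=\frac{\lambda}{\varphi^2},$$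 $$\left[f''\varphi^2f-(n-2)\varphi'\varphi ff'+(m-1)(f')^2\varphi^2-f'f\varphi^2h'\right]\|\alpha\|^2+\lambda f^2=\left[\frac{\tau''}{\tau}-(m-1)\left(\frac{\tau'}{\tau}\right)^2\right]\|\beta\|^2,$$ $$(m-2)\frac{\tau''}{\tau}-\theta(u')^2=0,$$ $$\left[\tau^2u''-(m-2)\tau\tau'u'\right]\|\beta\|^2=0.$$
   Context: On $\mathbb{R}^n$ and on $\mathbb{R}^m$, $g_0$ denotes a semi-Euclidean metric, $(g_0)_{ij}=\epsilon_i\delta_{ij}$ with $\epsilon_i=\pm1$ (signs indexed by $1,\dots,n$ on $\mathbb{R}^n$ and by $n+1,\dots,n+m$ on $\mathbb{R}^m$); $\|\alpha\|^2=\sum_{i=1}^n\epsilon_i\alpha_i^2$ and $\|\beta\|^2=\sum_{j=n+1}^{n+m}\epsilon_j\beta_j^2$. Functions of $\xi$ (resp. $\zeta$) are identified with functions of one real variable; primes denote derivatives with respect to $\xi$ for $\varphi,f,h$ and with respect to $\zeta$ for $\tau,u$. For a semi-Riemannian manifold $(M,g)$, smooth $u,h:M\to\mathbb{R}$ and $\lambda\in\mathbb{R}$, $(M,g,h,u,\lambda)$ is a gradient Ricci-harmonic soliton (GRHS) with constant $\theta\ge0$ if $$Ric_g+Hess\,h-\theta\,\nabla u\otimes\nabla u=\lambda g,\qquad \Delta_gu-g(\nabla u,\nabla h)=0,$$ where $(\nabla u\otimes\nabla u)(X,Y)=X(u)Y(u)$ and $\Delta_g=\mathrm{tr}_gHess$;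 $u$ is called the harmonic map.
   Formalization: Requires n ≥ 2 and m ≥ 2 (the equivalence fails for n = 1 or m = 1). The printed system is proved equivalent for m ≥ 3; at m = 2 it is false, and the third equation's right-hand side is multiplied by τ² (this corrected form is proved for all n, m ≥ 2). *)

theory Defs
  imports "HOL-Analysis.Analysis"
begin

section \<open>Smooth functions on a Euclidean space\<close>

text \<open>\<open>\<D> F p v\<close> is the derivative of \<open>F\<close> at \<open>p\<close> in the direction \<open>v\<close>.\<close>

abbreviation dird :: "('a::euclidean_space \<Rightarrow> 'b::real_normed_vector) \<Rightarrow> 'a \<Rightarrow> 'a \<Rightarrow> 'b" ("\<D>")
  where "\<D> F p v \<equiv> frechet_derivative F (at p) v"

primrec Ck :: "nat \<Rightarrow> ('a::euclidean_space \<Rightarrow> real) \<Rightarrow> bool" where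
  "Ck 0 F \<longleftrightarrow> continuous_on UNIV F"
| "Ck (Suc k) F \<longleftrightarrow> (\<forall>p. F differentiable (at p)) \<and> (\<forall>b\<in>Basis. Ck k (\<lambda>p. \<D> F p b))"

definition smooth :: "('a::euclidean_space \<Rightarrow> real) \<Rightarrow> bool" where
  "smooth F \<longleftrightarrow> (\<forall>k. Ck k F)"

section \<open>Semi-Riemannian geometry in a global chart\<close>

text \<open>
  The manifold is a Euclidean space \<open>'a\<close>, used only as a global chart: its inner product
  plays no role except through the coordinate frame \<open>Basis\<close>. All tangent spaces are
  identified with \<open>'a\<close>; a vector tangent at \<open>p\<close> is also regarded as the constant
  (coordinate) vector field with that value. A metric maps a point and two tangent vectors
  to a real number.
\<close>

type_synonym 'a metric = "'a \<Rightarrow> 'a \<Rightarrow> 'a \<Rightarrow> real"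

definition semi_riemannian :: "'a::euclidean_space metric \<Rightarrow> bool" where
  "semi_riemannian g \<longleftrightarrow>
     (\<forall>p. bilinear (g p)) \<and>
     (\<forall>p v w. g p v w = g p w v) \<and>
     (\<forall>p v. v \<noteq> 0 \<longrightarrow> (\<exists>w. g p v w \<noteq> 0)) \<and>
     (\<forall>v w. smooth (\<lambda>p. g p v w))"

text \<open>The vector metrically equivalent to the covector \<open>\<omega>\<close> at \<open>p\<close>
  (meaningful for linear \<open>\<omega>\<close> and nondegenerate \<open>g p\<close>).\<close>

definition sharp :: "'a::euclidean_space metric \<Rightarrow> 'a \<Rightarrow> ('a \<Rightarrow> real) \<Rightarrow> 'a" where
  "sharp g p \<omega> = (THE w. \<forall>v. g p w v = \<omega> v)"

definition grad :: "'a::euclidean_space metric \<Rightarrow> ('a \<Rightarrow> real) \<Rightarrow> 'a \<Rightarrow> 'a" where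
  "grad g F p = sharp g p (\<D> F p)"

text \<open>The Christoffel map: \<open>\<Gamma> g p v w\<close> is the Levi-Civita derivative \<open>\<nabla>\<^sub>v w\<close> of the constant
  vector field \<open>w\<close>, given by the Koszul formula, whose bracket terms vanish for constant
  fields.\<close>

definition Chr :: "'a::euclidean_space metric \<Rightarrow> 'a \<Rightarrow> 'a \<Rightarrow> 'a \<Rightarrow> 'a" ("\<Gamma>") where
  "\<Gamma> g p v w = sharp g p (\<lambda>z.
     (\<D> (\<lambda>q. g q w z) p v + \<D> (\<lambda>q. g q v z) p w - \<D> (\<lambda>q. g q v w) p z) / 2)"

definition cov :: "'a::euclidean_space metric \<Rightarrow> ('a \<Rightarrow> 'a) \<Rightarrow> ('a \<Rightarrow> 'a) \<Rightarrow> 'a \<Rightarrow> 'a" ("\<nabla>") where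
  "\<nabla> g X Y p = \<D> Y p (X p) + \<Gamma> g p (X p) (Y p)"

text \<open>\<open>R(x,y)z = \<nabla>\<^sub>x \<nabla>\<^sub>y z - \<nabla>\<^sub>y \<nabla>\<^sub>x z\<close> on constant fields, for which \<open>\<nabla>\<^bsub>[x,y]\<^esub> z = 0\<close>.\<close>

definition Riem :: "'a::euclidean_space metric \<Rightarrow> 'a \<Rightarrow> 'a \<Rightarrow> 'a \<Rightarrow> 'a \<Rightarrow> 'a" where
  "Riem g p x y z =
     \<nabla> g (\<lambda>_. x) (\<nabla> g (\<lambda>_. y) (\<lambda>_. z)) p - \<nabla> g (\<lambda>_. y) (\<nabla> g (\<lambda>_. x) (\<lambda>_. z)) p"

text \<open>\<open>Ric(y,z)\<close> is the trace of \<open>x \<mapsto> R(x,y)z\<close>; round spheres have positive Ricci curvature.\<close>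

definition Ric :: "'a::euclidean_space metric \<Rightarrow> 'a metric" where
  "Ric g p y z = (\<Sum>b\<in>Basis. Riem g p b y z \<bullet> b)"

text \<open>\<open>Hess F (v,w) = v (w F) - (\<nabla>\<^sub>v w) F\<close>.\<close>

definition Hess :: "'a::euclidean_space metric \<Rightarrow> ('a \<Rightarrow> real) \<Rightarrow> 'a metric" where
  "Hess g F p v w = \<D> (\<lambda>q. \<D> F q w) p v - \<D> F p (\<Gamma> g p v w)"

definition trace_g :: "'a::euclidean_space metric \<Rightarrow> 'a \<Rightarrow> ('a \<Rightarrow> 'a \<Rightarrow> real) \<Rightarrow> real" where
  "trace_g g p T = (\<Sum>b\<in>Basis. sharp g p (T b) \<bullet> b)"

definition Laplacian :: "'a::euclidean_space metric \<Rightarrow> ('a \<Rightarrow> real) \<Rightarrow> 'a \<Rightarrow> real" where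
  "Laplacian g F p = trace_g g p (Hess g F p)"

definition GRHS ::
  "'a::euclidean_space metric \<Rightarrow> ('a \<Rightarrow> real) \<Rightarrow> ('a \<Rightarrow> real) \<Rightarrow> real \<Rightarrow> real \<Rightarrow> bool" where
  "GRHS g h u lam \<theta> \<longleftrightarrow>
     semi_riemannian g \<and> smooth h \<and> smooth u \<and> \<theta> \<ge> 0 \<and>
     (\<forall>p v w. Ric g p v w + Hess g h p v w - \<theta> * (\<D> u p v * \<D> u p w) = lam * g p v w) \<and>
     (\<forall>p. Laplacian g u p - g p (grad g u p) (grad g h p) = 0)"

section \<open>Semi-Euclidean, conformal and warped product metrics\<close>

definition signs :: "('i \<Rightarrow> real) \<Rightarrow> bool" where
  "signs \<epsilon> \<longleftrightarrow> (\<forall>i. \<epsilon> i = 1 \<or> \<epsilon> i = - 1)"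

definition semi_euclidean :: "('i::finite \<Rightarrow> real) \<Rightarrow> (real^'i) metric" where
  "semi_euclidean \<epsilon> p v w = (\<Sum>i\<in>UNIV. \<epsilon> i * (v $ i) * (w $ i))"

text \<open>\<open>\<parallel>a\<parallel>\<^sup>2\<close> with respect to the signs; it may vanish or be negative for nonzero \<open>a\<close>.\<close>

definition sqnorm :: "('i::finite \<Rightarrow> real) \<Rightarrow> real^'i \<Rightarrow> real" where
  "sqnorm \<epsilon> a = (\<Sum>i\<in>UNIV. \<epsilon> i * (a $ i)^2)"

definition linform :: "real^'i \<Rightarrow> real^'i \<Rightarrow> real" where
  "linform a x = (\<Sum>i\<in>UNIV. a $ i * x $ i)"

text \<open>The metric \<open>\<phi>\<^sup>-\<^sup>2 g\<close>.\<close>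

definition conformal :: "('a \<Rightarrow> real) \<Rightarrow> 'a metric \<Rightarrow> 'a metric" where
  "conformal \<phi> g p v w = g p v w / (\<phi> p)^2"

text \<open>The metric \<open>\<pi>\<^sup>* g\<^sub>B + (F \<circ> \<pi>)\<^sup>2 \<sigma>\<^sup>* g\<^sub>F\<close>, where \<open>\<pi> = fst\<close> and \<open>\<sigma> = snd\<close>.\<close>

definition warped :: "'b metric \<Rightarrow> ('b \<Rightarrow> real) \<Rightarrow> 'f metric \<Rightarrow> ('b \<times> 'f) metric" where
  "warped gB F gF p v w =
     gB (fst p) (fst v) (fst w) + (F (fst p))^2 * gF (snd p) (snd v) (snd w)"

end

theory Submission
  imports Defs
begin

text \<open>
  All data depend on the two linear coordinates \<open>\<xi>\<close> and \<open>\<zeta>\<close> only, so the whole geometry can be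
  computed in closed form. A semi-Euclidean metric is \<open>g\<^sub>0 v w = J v \<bullet> w\<close> with \<open>J\<close> a self-adjoint
  linear involution, and nothing else about the signs is needed: \<open>J a\<close> is the \<open>g\<^sub>0\<close>-gradient of
  \<open>x \<mapsto> a \<bullet> x\<close>, and \<open>\<parallel>a\<parallel>\<^sup>2 = J a \<bullet> a\<close>. Writing \<open>J\<close>, \<open>K\<close> for the involutions of base and
  fiber and \<open>a\<close>, \<open>b\<close> for the two covectors, the Koszul formula gives the Christoffel map
  (\<open>Chr_g\<close>); differentiating it once more and taking traces of sums of rank-one operators and
  multiples of the identity gives the Ricci tensor (\<open>Ric_g\<close>). Together with the Hessian of \<open>h\<close>
  this makes the soliton equation a tensor identity
  \<open>P (a \<bullet> v\<^sub>1) (a \<bullet> w\<^sub>1) + Q (J v\<^sub>1 \<bullet> w\<^sub>1) + R (b \<bullet> v\<^sub>2) (b \<bullet> w\<^sub>2) + S (K v\<^sub>2 \<bullet> w\<^sub>2) = 0\<close>,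
  without mixed terms. Since both factors have dimension at least two, a nonzero vector can be
  chosen in the kernel of \<open>a\<close>, resp. of \<open>b\<close>, which forces \<open>P = Q = R = S = 0\<close>
  (\<open>rank_two_form_eq_0\<close>). These are the first four equations, where \<open>S = 0\<close> carries a factor
  \<open>\<tau>\<^sup>2\<close> on the fiber side. The gradients of \<open>u\<close> and \<open>h\<close> are orthogonal, so the harmonic map
  equation is \<open>\<Delta>u = 0\<close>, which is the fifth equation (\<open>GRHS_g_iff\<close>).

  For \<open>m \<ge> 3\<close> the factor \<open>\<tau>\<^sup>2\<close> in the third equation may be dropped, because the fourth and fifth
  equations make the expression that it multiplies vanish identically. This is trivial if
  \<open>\<parallel>\<beta>\<parallel>\<^sup>2 = 0\<close>. Otherwise these two equations have the first integral
  \<open>C = (m - 1) \<tau>'\<^sup>2 - \<tau> \<tau>''\<close>, and \<open>\<tau>\<close> is positive on the whole line. If \<open>C > 0\<close>, then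
  \<open>\<tau>'\<close> is bounded away from zero, which is impossible for a positive function; if \<open>C \<le> 0\<close>, then
  \<open>\<tau>\<^sup>2\<^sup>-\<^sup>m\<close> is positive and concave, hence constant. So \<open>\<tau>\<close> is constant
  (\<open>fiber_profile_constant\<close>).
\<close>

section \<open>Smooth functions\<close>

lemma dird_eq: "(F has_derivative F') (at p) \<Longrightarrow> \<D> F p = F'"
  by (metis frechet_derivative_at)

lemma dird_real_eq_deriv: "F differentiable (at s) \<Longrightarrow> \<D> F s v = v * deriv F s"
  for F :: "real \<Rightarrow> real"
  by (metis DERIV_imp_deriv frechet_derivative_at frechet_derivative_works
      has_field_derivative_def mult.commute real_differentiable_def
      real_differentiableE)

lemma has_derivative_comp_inner [derivative_intros]:
  assumes "(F has_real_derivative F') (at (c \<bullet> L p))" and "(L has_derivative L') (at p)"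
  shows "((\<lambda>p. F (c \<bullet> L p)) has_derivative (\<lambda>v. F' * (c \<bullet> L' v))) (at p)"
proof -
  have "((\<lambda>p. c \<bullet> L p) has_derivative (\<lambda>v. c \<bullet> L' v)) (at p)"
    by (rule has_derivative_inner_right[OF assms(2)])
  from has_derivative_compose[OF this] assms(1) show ?thesis
    by (simp add: has_field_derivative_def)
qed

lemma frechet_derivative_worksI: "F differentiable at p \<Longrightarrow> (F has_derivative \<D> F p) (at p)"
  by (simp add: frechet_derivative_works)

lemma Ck_Suc_imp_Ck: "Ck (Suc k) F \<Longrightarrow> Ck k F"
proof (induction k arbitrary: F)
  case 0
  then show ?case
    by (auto simp: differentiable_imp_continuous_within continuous_at_imp_continuous_on)
qed auto

lemma Ck_const: "Ck k (\<lambda>_. c)"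
  by (induction k arbitrary: c) auto

lemma Ck_add: "Ck k F \<Longrightarrow> Ck k G \<Longrightarrow> Ck k (\<lambda>p. F p + G p)"
proof (induction k arbitrary: F G)
  case (Suc k)
  have "((\<lambda>p. F p + G p) has_derivative (\<lambda>v. \<D> F p v + \<D> G p v)) (at p)" for p
    by (rule has_derivative_add) (use Suc.prems in \<open>auto intro: frechet_derivative_worksI\<close>)
  note D = this
  show ?case using Suc D by (auto simp: dird_eq[OF D] differentiable_def)
qed (auto intro: continuous_intros)

lemma Ck_mult: "Ck k F \<Longrightarrow> Ck k G \<Longrightarrow> Ck k (\<lambda>p. F p * G p)"
proof (induction k arbitrary: F G)
  case (Suc k)
  have "((\<lambda>p. F p * G p) has_derivative (\<lambda>v. F p * \<D> G p v + \<D> F p v * G p)) (at p)" for p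
    by (rule has_derivative_mult) (use Suc.prems in \<open>auto intro: frechet_derivative_worksI\<close>)
  note D = this
  have "Ck k F" "Ck k G" using Suc.prems Ck_Suc_imp_Ck by blast+
  then show ?case using Suc D by (auto simp: dird_eq[OF D] differentiable_def intro!: Ck_add)
qed (auto intro: continuous_intros)

lemma Ck_inverse: "Ck k F \<Longrightarrow> (\<And>p. F p \<noteq> 0) \<Longrightarrow> Ck k (\<lambda>p. inverse (F p))"
proof (induction k arbitrary: F)
  case (Suc k)
  have F: "F differentiable at p" for p using Suc.prems by simp
  have "((\<lambda>p. inverse (F p)) has_derivative (\<lambda>v. - (inverse (F p) * \<D> F p v * inverse (F p)))) (at p)" for p
    by (rule Deriv.has_derivative_inverse[OF Suc.prems(2) frechet_derivative_worksI[OF F]])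
  note D = this
  have "Ck k F" using Suc.prems(1) Ck_Suc_imp_Ck by blast
  then have "Ck k (\<lambda>p. inverse (F p))" using Suc.IH Suc.prems(2) by blast
  then have "Ck k (\<lambda>p. - 1 * (inverse (F p) * \<D> F p b * inverse (F p)))" if "b \<in> Basis" for b
    using that Suc.prems(1) by (intro Ck_mult Ck_const) auto
  moreover have "(\<lambda>p. inverse (F p)) differentiable at p" for p
    using D unfolding differentiable_def by blast
  ultimately show ?case by (simp add: dird_eq[OF D])
qed (auto intro!: continuous_intros)

lemma Ck_comp_inner:
  fixes L :: "'a::euclidean_space \<Rightarrow> 'b::euclidean_space" and F :: "real \<Rightarrow> real"
  assumes L: "bounded_linear L"
  shows "Ck k F \<Longrightarrow> Ck k (\<lambda>p. F (c \<bullet> L p))"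
proof (induction k arbitrary: F)
  case 0
  then show ?case
    using bounded_linear.continuous_on[OF L continuous_on_id]
    by (auto intro!: continuous_intros continuous_on_compose2[of UNIV F])
next
  case (Suc k)
  then have F: "F differentiable at s" for s by simp
  then have "(F has_real_derivative deriv F s) (at s)" for s
    by (metis DERIV_imp_deriv real_differentiableE real_differentiable_def)
  then have D: "((\<lambda>p. F (c \<bullet> L p)) has_derivative (\<lambda>v. deriv F (c \<bullet> L p) * (c \<bullet> L v))) (at p)" for p
    by (intro has_derivative_comp_inner bounded_linear_imp_has_derivative L)
  have "Ck k (deriv F)" using Suc.prems by (simp add: dird_real_eq_deriv[OF F])
  then show ?case using Suc.IH D
    by (auto simp: dird_eq[OF D] differentiable_def intro!: Ck_mult Ck_const)
qed

lemma smooth_const: "smooth (\<lambda>_. c)"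
  and smooth_add: "smooth F \<Longrightarrow> smooth G \<Longrightarrow> smooth (\<lambda>p. F p + G p)"
  and smooth_mult: "smooth F \<Longrightarrow> smooth G \<Longrightarrow> smooth (\<lambda>p. F p * G p)"
  and smooth_inverse: "smooth F \<Longrightarrow> (\<And>p. F p \<noteq> 0) \<Longrightarrow> smooth (\<lambda>p. inverse (F p))"
  by (auto simp: smooth_def intro: Ck_const Ck_add Ck_mult Ck_inverse)

lemma smooth_comp_inner:
  fixes L :: "'a::euclidean_space \<Rightarrow> 'b::euclidean_space" and F :: "real \<Rightarrow> real"
  shows "smooth F \<Longrightarrow> bounded_linear L \<Longrightarrow> smooth (\<lambda>p. F (c \<bullet> L p))"
  by (auto simp: smooth_def intro: Ck_comp_inner)

lemma smooth_has_real_derivative: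
  fixes F :: "real \<Rightarrow> real"
  assumes "smooth F"
  shows "(F has_real_derivative deriv F s) (at s)"
proof -
  have "Ck (Suc 0) F" using assms by (simp only: smooth_def)
  then show ?thesis by (metis Ck.simps(2) DERIV_imp_deriv real_differentiableE real_differentiable_def)
qed

lemma smooth_deriv:
  fixes F :: "real \<Rightarrow> real"
  assumes "smooth F"
  shows "smooth (deriv F)"
  unfolding smooth_def
proof
  fix k
  have "Ck (Suc k) F" using assms by (simp only: smooth_def)
  then have D: "F differentiable at s" and C: "Ck k (\<lambda>s. \<D> F s 1)" for s by auto
  show "Ck k (deriv F)" using C by (simp add: dird_real_eq_deriv[OF D])
qed

section \<open>Entire positive solutions of the fiber equations\<close>

lemma positive_concave_deriv_eq_0:
  fixes F F' F'' :: "real \<Rightarrow> real"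
  assumes F: "\<And>t. (F has_real_derivative F' t) (at t)"
    and F': "\<And>t. (F' has_real_derivative F'' t) (at t)"
    and neg: "\<And>t. F'' t \<le> 0" and pos: "\<And>t. F t > 0"
  shows "F' t = 0"
proof (rule ccontr)
  assume nz: "F' t \<noteq> 0"
  have anti: "F' y \<le> F' x" if "x \<le> y" for x y
    using DERIV_nonpos_imp_nonincreasing[OF that] F' neg by blast
  \<comment> \<open>The graph lies below its tangent at \<open>t\<close>, which crosses zero unless it is horizontal.\<close>
  have below: "F x \<le> F t + F' t * (x - t)" for x
  proof (cases x t rule: linorder_cases)
    case less
    then obtain z where "x < z" "z < t" "F t - F x = (t - x) * F' z"
      using MVT2[of x t F F'] F by auto
    moreover have "(t - x) * F' t \<le> (t - x) * F' z"
      using anti[of z t] less \<open>z < t\<close> by (intro mult_left_mono) auto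
    ultimately show ?thesis by (simp add: algebra_simps)
  next
    case greater
    then obtain z where "t < z" "z < x" "F x - F t = (x - t) * F' z"
      using MVT2[of t x F F'] F by auto
    moreover have "(x - t) * F' z \<le> (x - t) * F' t"
      using anti[of t z] greater \<open>t < z\<close> by (intro mult_left_mono) auto
    ultimately show ?thesis by (simp add: algebra_simps)
  qed simp
  have "F (t - F t / F' t) \<le> 0" using below[of "t - F t / F' t"] nz by simp
  then show False using pos[of "t - F t / F' t"] by simp
qed

lemma positive_deriv_not_bounded_below:
  fixes F F' :: "real \<Rightarrow> real"
  assumes F: "\<And>t. (F has_real_derivative F' t) (at t)"
    and pos: "\<And>t. F t > 0" and "d > 0" and low: "\<And>t. F' t \<ge> d"
  shows False
proof -
  define s where "s = - F 0 / d"
  have "s < 0" using pos[of 0] \<open>d > 0\<close> by (simp add: s_def)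
  then obtain z where "F 0 - F s = (0 - s) * F' z"
    using MVT2[of s 0 F F'] F by auto
  moreover have "(0 - s) * F' z \<ge> (0 - s) * d"
    using \<open>s < 0\<close> low[of z] by (intro mult_left_mono) auto
  ultimately have "F s \<le> 0" using \<open>d > 0\<close> by (simp add: s_def)
  then show False using pos[of s] by simp
qed

lemma positive_deriv_sq_not_bounded_below:
  fixes F F' :: "real \<Rightarrow> real"
  assumes F: "\<And>t. (F has_real_derivative F' t) (at t)"
    and cont: "continuous_on UNIV F'"
    and pos: "\<And>t. F t > 0" and d: "d > 0" and low: "\<And>t. (F' t)\<^sup>2 \<ge> d"
  shows False
proof -
  define e where "e = sqrt d"
  have e: "e > 0" "\<bar>F' t\<bar> \<ge> e" for t
    using d low[of t] real_le_rsqrt real_sqrt_le_mono by (fastforce simp: e_def)+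
  have con: "connected (range F')"
    using cont connected_continuous_image connected_UNIV by blast
  have nz: "0 \<notin> range F'" using e by (metis abs_0 imageE not_less)
  have "\<not> (F' s \<le> 0 \<and> F' t \<ge> 0)" for s t
    using connectedD_interval[OF con, of "F' s" "F' t" 0] nz by blast
  then consider "\<forall>t. F' t > 0" | "\<forall>t. F' t < 0" by (meson not_less)
  then show False
  proof cases
    case 1
    then have "F' t \<ge> e" for t using e(2)[of t] by (metis abs_of_pos)
    then show ?thesis using positive_deriv_not_bounded_below[OF F pos e(1)] by blast
  next
    case 2
    have "((\<lambda>t. F (- t)) has_real_derivative - F' (- t)) (at t)" for t
      using F[of "- t"] DERIV_mirror[of F "F' (- t)" t] by simp
    moreover have "- F' (- t) \<ge> e" for t using e(2)[of "-t"] 2 by (metis abs_of_neg)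
    ultimately show ?thesis
      using positive_deriv_not_bounded_below[of "\<lambda>t. F (- t)" "\<lambda>t. - F' (- t)" e] pos e(1) by blast
  qed
qed

text \<open>
  With \<open>N = m - 2\<close>, the fourth and fifth soliton equations (the latter divided by
  \<open>\<parallel>\<beta>\<parallel>\<^sup>2 \<noteq> 0\<close>) admit no global positive solution with nonconstant \<open>\<tau>\<close>.
\<close>

lemma fiber_profile_constant:
  fixes \<tau> u :: "real \<Rightarrow> real" and N :: nat and \<theta> :: real
  assumes \<tau>: "smooth \<tau>" and u: "smooth u" and pos: "\<And>t. \<tau> t > 0" and "N \<ge> 1" and "\<theta> \<ge> 0"
    and eq1: "\<And>t. N * (deriv (deriv \<tau>) t / \<tau> t) - \<theta> * (deriv u t)\<^sup>2 = 0"
    and eq2: "\<And>t. (\<tau> t)\<^sup>2 * deriv (deriv u) t - N * \<tau> t * deriv \<tau> t * deriv u t = 0"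
  shows "deriv \<tau> t = 0"
proof -
  note d\<tau> = smooth_has_real_derivative[OF \<tau>]
    and dd\<tau> = smooth_has_real_derivative[OF smooth_deriv[OF \<tau>]]
    and du = smooth_has_real_derivative[OF u]
    and ddu = smooth_has_real_derivative[OF smooth_deriv[OF u]]
  \<comment> \<open>\<open>C\<close> is a first integral.\<close>
  define C where "C t = (N + 1) * (deriv \<tau> t)\<^sup>2 - \<tau> t * deriv (deriv \<tau>) t" for t
  have \<tau>2: "deriv (deriv \<tau>) t = \<theta> / N * (deriv u t)\<^sup>2 * \<tau> t" for t
    using eq1[of t] pos[of t] \<open>N \<ge> 1\<close> by (simp add: field_simps)
  have u2: "deriv (deriv u) t = N * deriv \<tau> t * deriv u t / \<tau> t" for t
    using eq2[of t] pos[of t] by (simp add: field_simps power2_eq_square)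
  have C_eq: "C = (\<lambda>t. (N + 1) * (deriv \<tau> t)\<^sup>2 - \<theta> / N * (deriv u t)\<^sup>2 * (\<tau> t)\<^sup>2)"
    unfolding C_def \<tau>2 by (auto simp: power2_eq_square)
  have "(C has_real_derivative 0) (at t)" for t
    unfolding C_eq
    apply (rule derivative_eq_intros d\<tau> dd\<tau> du ddu refl)+
    unfolding \<tau>2 u2
    using pos[of t] \<open>N \<ge> 1\<close> by (simp add: field_simps power2_eq_square)
  then have C_const: "C s = C 0" for s using DERIV_isconst_all[of C] by blast
  have C_nonpos: "C 0 \<le> 0"
  proof (rule ccontr)
    assume C0: "\<not> C 0 \<le> 0"
    have low: "(deriv \<tau> t)\<^sup>2 \<ge> C 0 / (N + 1)" for t
    proof -
      have "\<theta> / N * (deriv u t)\<^sup>2 * (\<tau> t)\<^sup>2 \<ge> 0" using \<open>\<theta> \<ge> 0\<close> by simp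
      then have "C 0 \<le> (N + 1) * (deriv \<tau> t)\<^sup>2"
        using C_const[of t] fun_cong[OF C_eq, of t] by linarith
      then show ?thesis by (simp add: divide_le_eq mult.commute)
    qed
    have "Ck 0 (deriv \<tau>)" using smooth_deriv[OF \<tau>] unfolding smooth_def by blast
    then show False
      using positive_deriv_sq_not_bounded_below[OF d\<tau> _ pos _ low] C0 by simp
  qed
  \<comment> \<open>The second derivative of \<open>1 / \<tau>\<^sup>N\<close> is \<open>C\<close> times a positive function, so \<open>1 / \<tau>\<^sup>N\<close> is concave.\<close>
  define F' where "F' t = - N * deriv \<tau> t / \<tau> t ^ Suc N" for t
  have D1: "((\<lambda>t. 1 / \<tau> t ^ N) has_real_derivative F' t) (at t)" for t
  proof -
    obtain M where M: "N = Suc M" using \<open>N \<ge> 1\<close> by (cases N) auto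
    show ?thesis
      apply (rule derivative_eq_intros d\<tau> refl)+
      using pos[of t] by (simp_all add: F'_def M field_simps)
  qed
  have D2: "(F' has_real_derivative N / \<tau> t ^ (N + 2) * C t) (at t)" for t
    unfolding F'_def
    apply (rule derivative_eq_intros d\<tau> dd\<tau> refl)+
    using pos[of t] \<open>N \<ge> 1\<close> by (auto simp: C_def field_simps power2_eq_square)
  have "N / \<tau> t ^ (N + 2) * C t \<le> 0" for t
    unfolding C_const[of t] by (rule mult_nonneg_nonpos) (use C_nonpos pos[of t] in auto)
  from positive_concave_deriv_eq_0[OF D1 D2 this] have "F' t = 0"
    using pos by simp
  then show ?thesis using pos[of t] \<open>N \<ge> 1\<close> by (simp add: F'_def)
qed

section \<open>Traces of linear operators\<close>

text \<open>
  The trace of \<open>L\<close> in the orthonormal frame \<open>Basis\<close>; it is the trace in any frame when \<open>L\<close> is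
  linear, but linearity is not required by the rules below.
\<close>

definition tr :: "('a::euclidean_space \<Rightarrow> 'a) \<Rightarrow> real" where
  "tr L = (\<Sum>b\<in>Basis. L b \<bullet> b)"

lemma tr_add: "tr (\<lambda>x. L x + M x) = tr L + tr M"
  by (simp add: tr_def inner_add_left sum.distrib)

lemma tr_diff: "tr (\<lambda>x. L x - M x) = tr L - tr M"
  by (simp add: tr_def inner_diff_left sum_subtractf)

lemma tr_zero: "tr (\<lambda>x. 0) = 0"
  by (simp add: tr_def)

lemma tr_scale: "tr (\<lambda>x. c *\<^sub>R L x) = c * tr L"
  by (simp add: tr_def sum_distrib_left)

lemma tr_rank_one: "tr (\<lambda>x. (a \<bullet> x) *\<^sub>R v) = a \<bullet> v"
  by (simp add: tr_def euclidean_inner[of a v])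

lemma tr_rank_one_scaled: "tr (\<lambda>x. (c * (a \<bullet> x)) *\<^sub>R v) = c * (a \<bullet> v)"
  using tr_scale[of c "\<lambda>x. (a \<bullet> x) *\<^sub>R v"] by (simp add: tr_rank_one)

lemma tr_id: "tr (\<lambda>x::'a::euclidean_space. x) = DIM('a)"
  by (simp add: tr_def inner_same_Basis)

lemmas tr_simps = tr_add tr_diff tr_scale tr_rank_one tr_rank_one_scaled tr_id

text \<open>
  The trace on a product is the sum of the traces of the two diagonal blocks.
\<close>

lemma tr_prod:
  fixes L :: "'a::euclidean_space \<times> 'b::euclidean_space \<Rightarrow> 'a \<times> 'b"
  shows "(\<Sum>b\<in>Basis. L b \<bullet> b) = tr (\<lambda>x. fst (L (x, 0))) + tr (\<lambda>x. snd (L (0, x)))"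
proof -
  have "inj_on (\<lambda>x. (x, 0 :: 'b)) (Basis :: 'a set)" "inj_on (\<lambda>x. (0 :: 'a, x)) (Basis :: 'b set)"
    by (auto intro!: inj_onI)
  then show ?thesis
    unfolding tr_def Basis_prod_def
    by (subst sum.union_disjoint) (auto simp: sum.reindex inner_prod_def)
qed

section \<open>Semi-Euclidean metrics as self-adjoint involutions\<close>

text \<open>
  The bilinear form \<open>J v \<bullet> w\<close> is a constant semi-Euclidean metric in coordinate-free form: \<open>J\<close> is
  the diagonal matrix of signs in a suitable orthonormal frame.
\<close>

locale self_adjoint_involution =
  fixes J :: "'a::euclidean_space \<Rightarrow> 'a"
  assumes lin: "linear J" and invol [simp]: "J (J x) = x" and selfadj: "J x \<bullet> y = x \<bullet> J y"
begin

lemma J_inner_commute: "J x \<bullet> y = J y \<bullet> x"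
  using selfadj[of x y] by (simp add: inner_commute)

lemma inner_J_commute: "x \<bullet> J y = y \<bullet> J x"
  using selfadj[of x y] by (simp add: inner_commute)

lemma J_inner_J [simp]: "J x \<bullet> J y = x \<bullet> y"
  using selfadj[of x "J y"] by (simp add: invol)

lemma J_0 [simp]: "J 0 = 0" by (rule linear_0[OF lin])
lemma J_add: "J (x + y) = J x + J y" by (rule linear_add[OF lin])
lemma J_minus: "J (- x) = - J x" by (rule linear_neg[OF lin])
lemma J_diff: "J (x - y) = J x - J y" by (rule linear_diff[OF lin])
lemma J_scale: "J (c *\<^sub>R x) = c *\<^sub>R J x" by (rule linear_scale[OF lin])

text \<open>
  The forms \<open>a \<otimes> a\<close> and \<open>J\<close> are linearly independent in dimension at least two, even if \<open>a\<close> is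
  a null covector: test with a nonzero vector in the kernel of \<open>a\<close>.
\<close>

lemma rank_two_form_eq_0:
  assumes "2 \<le> DIM('a)" and "a \<noteq> 0"
    and zero: "\<And>v w. P * ((a \<bullet> v) * (a \<bullet> w)) + Q * (J v \<bullet> w) = 0"
  shows "P = 0 \<and> Q = 0"
proof -
  obtain v where "v \<noteq> 0" and "orthogonal a v"
    using orthogonal_to_vector_exists[OF assms(1)] by blast
  then have "Q = 0"
    using zero[of v "J v"] by (simp add: orthogonal_def)
  then show ?thesis using zero[of a a] \<open>a \<noteq> 0\<close> by simp
qed

text \<open>
  The change of the Levi-Civita connection under a conformal change of the metric \<open>J\<close>: the
  Christoffel map of \<open>e\<^bsup>2 w(a \<bullet> x)\<^esup> J\<close> is \<open>w'(a \<bullet> x)\<close> times \<open>conf a\<close>.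
\<close>

definition conf :: "'a \<Rightarrow> 'a \<Rightarrow> 'a \<Rightarrow> 'a" where
  "conf a x y = (a \<bullet> x) *\<^sub>R y + (a \<bullet> y) *\<^sub>R x - (J x \<bullet> y) *\<^sub>R J a"

lemma conf_0 [simp]: "conf a 0 y = 0" "conf a x 0 = 0"
  by (simp_all add: conf_def)

lemma conf_commute: "conf a x y = conf a y x"
  by (simp add: conf_def J_inner_commute[of x y])

lemma conf_add: "conf a x (y + z) = conf a x y + conf a x z"
  by (simp add: conf_def inner_simps algebra_simps)
lemma conf_diff: "conf a x (y - z) = conf a x y - conf a x z"
  by (simp add: conf_def inner_simps algebra_simps)
lemma conf_scale: "conf a x (c *\<^sub>R y) = c *\<^sub>R conf a x y"
  by (simp add: conf_def algebra_simps)

lemma inner_conf: "a \<bullet> conf a x y = 2 * (a \<bullet> x) * (a \<bullet> y) - (J x \<bullet> y) * (J a \<bullet> a)"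
  by (simp add: conf_def inner_simps inner_commute)

lemma J_conf_inner: "J (conf a x y) \<bullet> z
    = (a \<bullet> x) * (J y \<bullet> z) + (a \<bullet> y) * (J x \<bullet> z) - (J x \<bullet> y) * (a \<bullet> z)"
  by (simp add: selfadj conf_def inner_simps)

lemma tr_conf: "tr (\<lambda>x. conf a x z) = DIM('a) * (a \<bullet> z)"
proof -
  have "conf a x z = (a \<bullet> x) *\<^sub>R z + (a \<bullet> z) *\<^sub>R x - (J z \<bullet> x) *\<^sub>R J a" for x
    by (simp add: conf_def J_inner_commute[of x z])
  then show ?thesis by (simp add: tr_simps) (simp add: inner_commute)
qed

lemma tr_conf_conf:
  "tr (\<lambda>x. conf a y (conf a x z))
     = (DIM('a) + 2) * (a \<bullet> y) * (a \<bullet> z) - 2 * (J a \<bullet> a) * (J y \<bullet> z)"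
proof -
  have "conf a y (conf a x z) =
      (a \<bullet> x) *\<^sub>R conf a y z + (a \<bullet> z) *\<^sub>R conf a y x - (J z \<bullet> x) *\<^sub>R conf a y (J a)" for x
    by (simp add: conf_def[of a x z] conf_add conf_diff conf_scale J_inner_commute[of x z])
  moreover have "tr (conf a y) = DIM('a) * (a \<bullet> y)"
    using tr_conf[of a y] by (simp add: conf_commute[of a _ y])
  ultimately have "tr (\<lambda>x. conf a y (conf a x z))
      = a \<bullet> conf a y z + (a \<bullet> z) * (DIM('a) * (a \<bullet> y)) - J z \<bullet> conf a y (J a)"
    by (simp only: tr_simps)
  also have "J z \<bullet> conf a y (J a) = (J a \<bullet> a) * (J y \<bullet> z) "
    by (simp add: conf_def inner_simps selfadj) (simp add: inner_commute inner_J_commute)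
  finally show ?thesis by (simp add: inner_conf algebra_simps)
qed

end

section \<open>The warped product metric\<close>

text \<open>
  Base and fiber are conformal to the constant metrics \<open>J\<close> and \<open>K\<close>; the base factor \<open>\<phi>\<^sup>-\<^sup>2\<close> and
  the warping function \<open>f\<close> depend on \<open>\<xi> = a \<bullet> x\<close>, the fiber factor \<open>\<tau>\<^sup>-\<^sup>2\<close> on \<open>\<zeta> = b \<bullet> y\<close>.
\<close>

locale conformal_warp =
  J: self_adjoint_involution J + K: self_adjoint_involution K
  for J :: "'a::euclidean_space \<Rightarrow> 'a" and K :: "'b::euclidean_space \<Rightarrow> 'b" +
  fixes a :: 'a and b :: 'b and \<phi> f \<tau> :: "real \<Rightarrow> real"
  assumes smooth_\<phi>: "smooth \<phi>" and smooth_f: "smooth f" and smooth_\<tau>: "smooth \<tau>"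
    and \<phi>_pos: "\<phi> s > 0" and f_pos: "f s > 0" and \<tau>_pos: "\<tau> t > 0"
begin

abbreviation \<xi> :: "'a \<times> 'b \<Rightarrow> real" where "\<xi> p \<equiv> a \<bullet> fst p"
abbreviation \<zeta> :: "'a \<times> 'b \<Rightarrow> real" where "\<zeta> p \<equiv> b \<bullet> snd p"

text \<open>The metric \<open>\<phi>\<^sup>-\<^sup>2 J + f\<^sup>2 \<tau>\<^sup>-\<^sup>2 K\<close>.\<close>

definition g :: "('a \<times> 'b) metric" where
  "g p v w = J (fst v) \<bullet> fst w / (\<phi> (\<xi> p))\<^sup>2
     + (f (\<xi> p))\<^sup>2 * (K (snd v) \<bullet> snd w / (\<tau> (\<zeta> p))\<^sup>2)"

lemmas d\<phi> = smooth_has_real_derivative[OF smooth_\<phi>]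
  and df = smooth_has_real_derivative[OF smooth_f]
  and d\<tau> = smooth_has_real_derivative[OF smooth_\<tau>]
  and dd\<phi> = smooth_has_real_derivative[OF smooth_deriv[OF smooth_\<phi>]]
  and ddf = smooth_has_real_derivative[OF smooth_deriv[OF smooth_f]]
  and dd\<tau> = smooth_has_real_derivative[OF smooth_deriv[OF smooth_\<tau>]]

lemma nonzero [simp]: "\<phi> s \<noteq> 0" "f s \<noteq> 0" "\<tau> s \<noteq> 0"
  using \<phi>_pos[of s] f_pos[of s] \<tau>_pos[of s] by auto

lemma bilinear_g: "bilinear (g p)"
  unfolding bilinear_def g_def
  by (auto intro!: linearI simp: J.J_add J.J_scale K.J_add K.J_scale inner_simps
      add_divide_distrib algebra_simps)

lemma g_commute: "g p v w = g p w v"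
  by (simp add: g_def J.J_inner_commute[of "fst v"] K.J_inner_commute[of "snd v"])

lemma g_nondegenerate:
  assumes "v \<noteq> 0" obtains w where "g p v w \<noteq> 0"
proof (cases "fst v = 0")
  case True
  then have "snd v \<noteq> 0" using assms by (metis prod.collapse zero_prod_def)
  then show ?thesis using that[of "(0, K (snd v))"] by (simp add: g_def)
next
  case False
  then show ?thesis using that[of "(J (fst v), 0)"] by (simp add: g_def)
qed

lemma sharp_g_eqI:
  assumes "\<And>v. g p w v = \<omega> v"
  shows "sharp g p \<omega> = w"
  unfolding sharp_def
proof (rule the_equality)
  fix w' assume w': "\<forall>v. g p w' v = \<omega> v"
  have "g p (w' - w) v = 0" for v
    unfolding bilinear_lsub[OF bilinear_g] assms by (simp only: w' diff_self)
  then show "w' = w" using g_nondegenerate by (metis eq_iff_diff_eq_0)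
qed (use assms in auto)

lemma semi_riemannian_g: "semi_riemannian g"
proof -
  have bl: "bounded_linear (fst :: 'a \<times> 'b \<Rightarrow> 'a)" "bounded_linear (snd :: 'a \<times> 'b \<Rightarrow> 'b)"
    by (rule bounded_linear_fst bounded_linear_snd)+
  have "smooth (\<lambda>p. g p v w)" for v w
  proof -
    have "g p v w = (J (fst v) \<bullet> fst w) * (inverse (\<phi> (\<xi> p)) * inverse (\<phi> (\<xi> p)))
      + (f (\<xi> p) * f (\<xi> p)) * ((K (snd v) \<bullet> snd w) *
          (inverse (\<tau> (\<zeta> p)) * inverse (\<tau> (\<zeta> p))))" for p
      by (simp add: g_def power2_eq_square field_simps)
    then show ?thesis
      by (auto intro!: smooth_add smooth_mult smooth_const smooth_inverse
          smooth_comp_inner bl smooth_\<phi> smooth_f smooth_\<tau>)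
  qed
  then show ?thesis
    unfolding semi_riemannian_def
    using bilinear_g g_commute g_nondegenerate by metis
qed

section \<open>The Christoffel map\<close>

text \<open>
  The logarithmic derivatives of \<open>\<phi>\<^sup>-\<^sup>1\<close>, \<open>f\<close> and \<open>\<tau>\<^sup>-\<^sup>1\<close>, and the coefficient with which the
  second fundamental form of the fibers enters the Christoffel map. The primed functions are
  their derivatives; the suffixes \<open>s\<close> and \<open>t\<close> denote the partial derivatives in \<open>\<xi>\<close> and \<open>\<zeta>\<close>.
\<close>

definition "base_rate s = - deriv \<phi> s / \<phi> s"
definition "warp_rate s = deriv f s / f s"
definition "fiber_rate t = - deriv \<tau> t / \<tau> t"
definition "mixed_coeff s t = f s * deriv f s * (\<phi> s)\<^sup>2 / (\<tau> t)\<^sup>2"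
definition "base_rate' s = (deriv \<phi> s / \<phi> s)\<^sup>2 - deriv (deriv \<phi>) s / \<phi> s"
definition "warp_rate' s = deriv (deriv f) s / f s - (deriv f s / f s)\<^sup>2"
definition "fiber_rate' t = (deriv \<tau> t / \<tau> t)\<^sup>2 - deriv (deriv \<tau>) t / \<tau> t"
definition "mixed_coeff_s s t =
  ((deriv f s)\<^sup>2 * (\<phi> s)\<^sup>2 + f s * deriv (deriv f) s * (\<phi> s)\<^sup>2
     + 2 * f s * deriv f s * \<phi> s * deriv \<phi> s) / (\<tau> t)\<^sup>2"
definition "mixed_coeff_t s t = - 2 * f s * deriv f s * (\<phi> s)\<^sup>2 * deriv \<tau> t / (\<tau> t) ^ 3"

lemma d_base_rate: "(base_rate has_real_derivative base_rate' s) (at s)"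
  unfolding base_rate_def base_rate'_def
  by (rule derivative_eq_intros d\<phi> dd\<phi> refl | simp)+ (simp add: field_simps power2_eq_square)
lemma d_warp_rate: "(warp_rate has_real_derivative warp_rate' s) (at s)"
  unfolding warp_rate_def warp_rate'_def
  by (rule derivative_eq_intros df ddf refl | simp)+ (simp add: field_simps power2_eq_square)
lemma d_mixed_coeff: "((\<lambda>p. mixed_coeff (\<xi> p) (\<zeta> p)) has_derivative
   (\<lambda>x. mixed_coeff_s (\<xi> p) (\<zeta> p) * (a \<bullet> fst x) + mixed_coeff_t (\<xi> p) (\<zeta> p) * (b \<bullet> snd x))) (at p)"
  unfolding mixed_coeff_def mixed_coeff_s_def mixed_coeff_t_def
  apply (rule derivative_eq_intros d\<phi> df ddf d\<tau> refl | simp)+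
  apply (simp add: field_simps power2_eq_square power3_eq_cube)
  done
lemma d_fiber_rate: "(fiber_rate has_real_derivative fiber_rate' s) (at s)"
  unfolding fiber_rate_def fiber_rate'_def
  by (rule derivative_eq_intros d\<tau> dd\<tau> refl | simp)+ (simp add: field_simps power2_eq_square)

lemma d_inv_\<phi>_sq: "((\<lambda>s. inverse ((\<phi> s)\<^sup>2))
    has_real_derivative 2 * base_rate s * inverse ((\<phi> s)\<^sup>2)) (at s)"
  apply (rule derivative_eq_intros d\<phi> refl)+
  apply simp
  apply (simp add: base_rate_def divide_simps)
  apply (simp add: power2_eq_square power4_eq_xxxx)
  done
lemma d_inv_\<tau>_sq: "((\<lambda>s. inverse ((\<tau> s)\<^sup>2))
    has_real_derivative 2 * fiber_rate s * inverse ((\<tau> s)\<^sup>2)) (at s)"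
  apply (rule derivative_eq_intros d\<tau> refl)+
  apply simp
  apply (simp add: fiber_rate_def divide_simps)
  apply (simp add: power2_eq_square power4_eq_xxxx)
  done
lemma d_f_sq: "((\<lambda>s. (f s)\<^sup>2) has_real_derivative 2 * warp_rate s * (f s)\<^sup>2) (at s)"
  by (rule derivative_eq_intros df refl | simp)+ (simp add: warp_rate_def field_simps power2_eq_square)

lemma d_g:
  "((\<lambda>p. g p v w) has_derivative (\<lambda>x.
     2 * base_rate (\<xi> p) * (a \<bullet> fst x) * (J (fst v) \<bullet> fst w / (\<phi> (\<xi> p))\<^sup>2)
     + 2 * (warp_rate (\<xi> p) * (a \<bullet> fst x) + fiber_rate (\<zeta> p) * (b \<bullet> snd x))
         * ((f (\<xi> p))\<^sup>2 * (K (snd v) \<bullet> snd w / (\<tau> (\<zeta> p))\<^sup>2)))) (at p)"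
  unfolding g_def divide_inverse
  apply (rule has_derivative_eq_rhs)
  apply (rule has_derivative_add has_derivative_mult has_derivative_const
    has_derivative_comp_inner[OF d_inv_\<phi>_sq has_derivative_fst[OF has_derivative_ident]]
    has_derivative_comp_inner[OF d_f_sq has_derivative_fst[OF has_derivative_ident]]
    has_derivative_comp_inner[OF d_inv_\<tau>_sq has_derivative_snd[OF has_derivative_ident]])+
  apply (simp add: algebra_simps)
  done

lemma mixed_coeff_eq: "mixed_coeff s t = warp_rate s * (f s)\<^sup>2 * (\<phi> s)\<^sup>2 / (\<tau> t)\<^sup>2"
  by (simp add: mixed_coeff_def warp_rate_def power2_eq_square)

lemma Chr_g:
  "\<Gamma> g p x y =
     (base_rate (\<xi> p) *\<^sub>R J.conf a (fst x) (fst y)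
        - (mixed_coeff (\<xi> p) (\<zeta> p) * (K (snd x) \<bullet> snd y)) *\<^sub>R J a,
      (warp_rate (\<xi> p) * (a \<bullet> fst x)) *\<^sub>R snd y + (warp_rate (\<xi> p) * (a \<bullet> fst y)) *\<^sub>R snd x
        + fiber_rate (\<zeta> p) *\<^sub>R K.conf b (snd x) (snd y))"
  unfolding Chr_def
proof (rule sharp_g_eqI)
  fix z
  show "g p (base_rate (\<xi> p) *\<^sub>R J.conf a (fst x) (fst y)
        - (mixed_coeff (\<xi> p) (\<zeta> p) * (K (snd x) \<bullet> snd y)) *\<^sub>R J a,
      (warp_rate (\<xi> p) * (a \<bullet> fst x)) *\<^sub>R snd y + (warp_rate (\<xi> p) * (a \<bullet> fst y)) *\<^sub>R snd x
        + fiber_rate (\<zeta> p) *\<^sub>R K.conf b (snd x) (snd y)) z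
    = (\<D> (\<lambda>q. g q y z) p x + \<D> (\<lambda>q. g q x z) p y - \<D> (\<lambda>q. g q x y) p z) / 2"
    unfolding dird_eq[OF d_g]
    by (simp add: g_def mixed_coeff_eq J.J_diff J.J_scale K.J_add K.J_scale J.J_conf_inner K.J_conf_inner
        inner_simps divide_simps) (simp add: algebra_simps)
qed

lemma d_Chr_g:
  "((\<lambda>p. \<Gamma> g p y z) has_derivative (\<lambda>x.
     ((base_rate' (\<xi> p) * (a \<bullet> fst x)) *\<^sub>R J.conf a (fst y) (fst z)
        - ((mixed_coeff_s (\<xi> p) (\<zeta> p) * (a \<bullet> fst x) + mixed_coeff_t (\<xi> p) (\<zeta> p) * (b \<bullet> snd x))
            * (K (snd y) \<bullet> snd z)) *\<^sub>R J a,
      (warp_rate' (\<xi> p) * (a \<bullet> fst x) * (a \<bullet> fst y)) *\<^sub>R snd z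
        + (warp_rate' (\<xi> p) * (a \<bullet> fst x) * (a \<bullet> fst z)) *\<^sub>R snd y
        + (fiber_rate' (\<zeta> p) * (b \<bullet> snd x)) *\<^sub>R K.conf b (snd y) (snd z)))) (at p)"
  unfolding Chr_g
  apply (rule has_derivative_eq_rhs)
  apply (rule has_derivative_Pair has_derivative_add has_derivative_diff has_derivative_scaleR_left
     has_derivative_mult_left d_mixed_coeff
    has_derivative_comp_inner[OF d_base_rate has_derivative_fst[OF has_derivative_ident]]
    has_derivative_comp_inner[OF d_warp_rate has_derivative_fst[OF has_derivative_ident]]
    has_derivative_comp_inner[OF d_fiber_rate has_derivative_snd[OF has_derivative_ident]])+
  apply simp
  done

section \<open>The Ricci tensor\<close>

lemma Riem_g: "Riem g p x y z =
   \<D> (\<lambda>p. \<Gamma> g p y z) p x - \<D> (\<lambda>p. \<Gamma> g p x z) p y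
   + \<Gamma> g p x (\<Gamma> g p y z) - \<Gamma> g p y (\<Gamma> g p x z)"
proof -
  have "\<nabla> g (\<lambda>_. v) (\<lambda>_. w) = (\<lambda>p. \<Gamma> g p v w)" for v w
    by (rule ext) (simp add: cov_def)
  then show ?thesis by (simp add: Riem_def) (simp add: cov_def)
qed

text \<open>
  The Ricci tensor is the sum of the traces of the base block and of the fiber block of
  \<open>x \<mapsto> R(x,y)z\<close>. Each block is a combination of rank-one operators, the identity and \<open>conf\<close>,
  whose traces are known.
\<close>

lemma tr_Riem_base:
  "tr (\<lambda>x. fst (Riem g p (x, 0) y z)) =
     base_rate' (\<xi> p) * (a \<bullet> J.conf a (fst y) (fst z))
     - mixed_coeff_s (\<xi> p) (\<zeta> p) * (K (snd y) \<bullet> snd z) * (J a \<bullet> a)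
     - base_rate' (\<xi> p) * (a \<bullet> fst y) * (DIM('a) * (a \<bullet> fst z))
     + base_rate (\<xi> p) * (DIM('a) * (a \<bullet> fst (\<Gamma> g p y z)))
     - (base_rate (\<xi> p))\<^sup>2 * tr (\<lambda>x. J.conf a (fst y) (J.conf a x (fst z)))
     + mixed_coeff (\<xi> p) (\<zeta> p) * warp_rate (\<xi> p) * (K (snd y) \<bullet> snd z) * (J a \<bullet> a)"
proof -
  have "fst (Riem g p (x, 0) y z) =
     (base_rate' (\<xi> p) * (a \<bullet> x)) *\<^sub>R J.conf a (fst y) (fst z)
     - (mixed_coeff_s (\<xi> p) (\<zeta> p) * (K (snd y) \<bullet> snd z) * (a \<bullet> x)) *\<^sub>R J a
     - (base_rate' (\<xi> p) * (a \<bullet> fst y)) *\<^sub>R J.conf a x (fst z)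
     + base_rate (\<xi> p) *\<^sub>R J.conf a x (fst (\<Gamma> g p y z))
     - (base_rate (\<xi> p))\<^sup>2 *\<^sub>R J.conf a (fst y) (J.conf a x (fst z))
     + (mixed_coeff (\<xi> p) (\<zeta> p) * warp_rate (\<xi> p) * (K (snd y) \<bullet> snd z) * (a \<bullet> x)) *\<^sub>R J a" for x
    unfolding Riem_g dird_eq[OF d_Chr_g] Chr_g[of p "(x, 0)" "\<Gamma> g p y z"]
      Chr_g[of p "y" "\<Gamma> g p (x, 0) z"]
    unfolding Chr_g[of p "(x, 0)" z]
    by (simp add: J.conf_scale inner_simps power2_eq_square algebra_simps)
  then show ?thesis
    by (simp only: tr_simps J.tr_conf) (simp add: inner_commute)
qed

lemma tr_Riem_fiber:
  "tr (\<lambda>x. snd (Riem g p (0, x) y z)) =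
     fiber_rate' (\<zeta> p) * (b \<bullet> K.conf b (snd y) (snd z))
     - warp_rate' (\<xi> p) * (a \<bullet> fst y) * (a \<bullet> fst z) * DIM('b)
     - fiber_rate' (\<zeta> p) * (b \<bullet> snd y) * (DIM('b) * (b \<bullet> snd z))
     + warp_rate (\<xi> p) * (a \<bullet> fst (\<Gamma> g p y z)) * DIM('b)
     + fiber_rate (\<zeta> p) * (DIM('b) * (b \<bullet> snd (\<Gamma> g p y z)))
     - (warp_rate (\<xi> p))\<^sup>2 * (a \<bullet> fst y) * (a \<bullet> fst z) * DIM('b)
     - warp_rate (\<xi> p) * fiber_rate (\<zeta> p) * (a \<bullet> fst y) * (DIM('b) * (b \<bullet> snd z))
     + warp_rate (\<xi> p) * mixed_coeff (\<xi> p) (\<zeta> p) * (J a \<bullet> a) * (K (snd z) \<bullet> snd y)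
     - warp_rate (\<xi> p) * fiber_rate (\<zeta> p) * (a \<bullet> fst z) * (DIM('b) * (b \<bullet> snd y))
     - (fiber_rate (\<zeta> p))\<^sup>2 * tr (\<lambda>x. K.conf b (snd y) (K.conf b x (snd z)))"
proof -
  have "snd (Riem g p (0, x) y z) =
     (fiber_rate' (\<zeta> p) * (b \<bullet> x)) *\<^sub>R K.conf b (snd y) (snd z)
     - (warp_rate' (\<xi> p) * (a \<bullet> fst y) * (a \<bullet> fst z)) *\<^sub>R x
     - (fiber_rate' (\<zeta> p) * (b \<bullet> snd y)) *\<^sub>R K.conf b x (snd z)
     + (warp_rate (\<xi> p) * (a \<bullet> fst (\<Gamma> g p y z))) *\<^sub>R x
     + fiber_rate (\<zeta> p) *\<^sub>R K.conf b x (snd (\<Gamma> g p y z))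
     - ((warp_rate (\<xi> p))\<^sup>2 * (a \<bullet> fst y) * (a \<bullet> fst z)) *\<^sub>R x
     - (warp_rate (\<xi> p) * fiber_rate (\<zeta> p) * (a \<bullet> fst y)) *\<^sub>R K.conf b x (snd z)
     + (warp_rate (\<xi> p) * mixed_coeff (\<xi> p) (\<zeta> p) * (J a \<bullet> a) * (K (snd z) \<bullet> x)) *\<^sub>R snd y
     - (warp_rate (\<xi> p) * fiber_rate (\<zeta> p) * (a \<bullet> fst z)) *\<^sub>R K.conf b x (snd y)
     - (fiber_rate (\<zeta> p))\<^sup>2 *\<^sub>R K.conf b (snd y) (K.conf b x (snd z))" for x
    unfolding Riem_g dird_eq[OF d_Chr_g] Chr_g[of p "(0, x)" "\<Gamma> g p y z"]
      Chr_g[of p "y" "\<Gamma> g p (0, x) z"]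
    unfolding Chr_g[of p "(0, x)" z]
    by (simp add: K.conf_scale K.conf_add inner_simps power2_eq_square
        K.conf_commute[of b "snd y" x] K.J_inner_commute[of x "snd z"] inner_commute[of a "J a"]
        algebra_simps)
  then show ?thesis
    by (simp only: tr_simps K.tr_conf)
qed

lemma Ric_g:
  fixes n m :: real
  defines "n \<equiv> DIM('a)" and "m \<equiv> DIM('b)"
  shows "Ric g p y z =
     ((n - 2) * (deriv (deriv \<phi>) (\<xi> p) / \<phi> (\<xi> p)) - m * (deriv (deriv f) (\<xi> p) / f (\<xi> p))
        - 2 * m * (deriv \<phi> (\<xi> p) / \<phi> (\<xi> p)) * (deriv f (\<xi> p) / f (\<xi> p)))
       * ((a \<bullet> fst y) * (a \<bullet> fst z))
     + (deriv (deriv \<phi>) (\<xi> p) / \<phi> (\<xi> p) - (n - 1) * (deriv \<phi> (\<xi> p) / \<phi> (\<xi> p))\<^sup>2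
        + m * (deriv \<phi> (\<xi> p) / \<phi> (\<xi> p)) * (deriv f (\<xi> p) / f (\<xi> p))) * (J a \<bullet> a)
       * (J (fst y) \<bullet> fst z)
     + (m - 2) * (deriv (deriv \<tau>) (\<zeta> p) / \<tau> (\<zeta> p)) * ((b \<bullet> snd y) * (b \<bullet> snd z))
     + ((deriv (deriv \<tau>) (\<zeta> p) / \<tau> (\<zeta> p) - (m - 1) * (deriv \<tau> (\<zeta> p) / \<tau> (\<zeta> p))\<^sup>2) * (K b \<bullet> b)
        - (deriv (deriv f) (\<xi> p) * (\<phi> (\<xi> p))\<^sup>2 * f (\<xi> p)
             - (n - 2) * deriv \<phi> (\<xi> p) * \<phi> (\<xi> p) * f (\<xi> p) * deriv f (\<xi> p)
             + (m - 1) * (deriv f (\<xi> p))\<^sup>2 * (\<phi> (\<xi> p))\<^sup>2) * (J a \<bullet> a) / (\<tau> (\<zeta> p))\<^sup>2)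
       * (K (snd y) \<bullet> snd z)"
proof -
  let ?s = "\<xi> p" and ?t = "\<zeta> p"
  let ?A = "(a \<bullet> fst y) * (a \<bullet> fst z)" and ?B = "(b \<bullet> snd y) * (b \<bullet> snd z)"
  let ?J = "J (fst y) \<bullet> fst z" and ?K = "K (snd y) \<bullet> snd z"
  have "Ric g p y z =
      ((2 - n) * base_rate' ?s - m * warp_rate' ?s + (n - 2) * (base_rate ?s)\<^sup>2
          + 2 * m * base_rate ?s * warp_rate ?s - m * (warp_rate ?s)\<^sup>2) * ?A
      + (- (base_rate' ?s + (n - 2) * (base_rate ?s)\<^sup>2 + m * base_rate ?s * warp_rate ?s)) * (J a \<bullet> a) * ?J
      + ((2 - m) * fiber_rate' ?t + (m - 2) * (fiber_rate ?t)\<^sup>2) * ?B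
      + (- (fiber_rate' ?t + (m - 2) * (fiber_rate ?t)\<^sup>2) * (K b \<bullet> b)
         + (2 * mixed_coeff ?s ?t * warp_rate ?s - mixed_coeff_s ?s ?t
           - (n * base_rate ?s + m * warp_rate ?s) * mixed_coeff ?s ?t) * (J a \<bullet> a)) * ?K"
    unfolding Ric_def tr_prod tr_Riem_base tr_Riem_fiber J.tr_conf_conf K.tr_conf_conf Chr_g
      fst_conv snd_conv inner_simps J.inner_conf K.inner_conf n_def[symmetric] m_def[symmetric]
      inner_commute[of a "J a"] K.J_inner_commute[of "snd z" "snd y"]
    by (simp add: n_def m_def algebra_simps power2_eq_square)
  moreover have "(2 - n) * base_rate' ?s - m * warp_rate' ?s + (n - 2) * (base_rate ?s)\<^sup>2
      + 2 * m * base_rate ?s * warp_rate ?s - m * (warp_rate ?s)\<^sup>2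
     = (n - 2) * (deriv (deriv \<phi>) ?s / \<phi> ?s) - m * (deriv (deriv f) ?s / f ?s)
        - 2 * m * (deriv \<phi> ?s / \<phi> ?s) * (deriv f ?s / f ?s)"
    by (simp add: base_rate_def warp_rate_def base_rate'_def warp_rate'_def
        add_divide_distrib diff_divide_distrib algebra_simps power2_eq_square)
  moreover have "- (base_rate' ?s + (n - 2) * (base_rate ?s)\<^sup>2 + m * base_rate ?s * warp_rate ?s)
     = deriv (deriv \<phi>) ?s / \<phi> ?s - (n - 1) * (deriv \<phi> ?s / \<phi> ?s)\<^sup>2
        + m * (deriv \<phi> ?s / \<phi> ?s) * (deriv f ?s / f ?s)"
    by (simp add: base_rate_def warp_rate_def base_rate'_def warp_rate'_def
        add_divide_distrib diff_divide_distrib algebra_simps power2_eq_square)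
  moreover have "(2 - m) * fiber_rate' ?t + (m - 2) * (fiber_rate ?t)\<^sup>2 = (m - 2) * (deriv (deriv \<tau>) ?t / \<tau> ?t)"
    by (simp add: fiber_rate_def fiber_rate'_def add_divide_distrib diff_divide_distrib
        algebra_simps power2_eq_square)
  moreover have "- (fiber_rate' ?t + (m - 2) * (fiber_rate ?t)\<^sup>2)
     = deriv (deriv \<tau>) ?t / \<tau> ?t - (m - 1) * (deriv \<tau> ?t / \<tau> ?t)\<^sup>2"
    by (simp add: fiber_rate_def fiber_rate'_def add_divide_distrib diff_divide_distrib
        algebra_simps power2_eq_square)
  moreover have "2 * mixed_coeff ?s ?t * warp_rate ?s - mixed_coeff_s ?s ?t
           - (n * base_rate ?s + m * warp_rate ?s) * mixed_coeff ?s ?t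
     = - ((deriv (deriv f) ?s * (\<phi> ?s)\<^sup>2 * f ?s
             - (n - 2) * deriv \<phi> ?s * \<phi> ?s * f ?s * deriv f ?s
             + (m - 1) * (deriv f ?s)\<^sup>2 * (\<phi> ?s)\<^sup>2) / (\<tau> ?t)\<^sup>2)"
    by (simp add: mixed_coeff_def mixed_coeff_s_def base_rate_def warp_rate_def field_simps power2_eq_square)
  ultimately show ?thesis
    by (simp only: mult_minus_left times_divide_eq_left add_uminus_conv_diff)
qed

section \<open>Functions of one linear coordinate\<close>

lemma d_base_function:
  assumes h: "smooth h"
  shows "\<D> (\<lambda>p. h (\<xi> p)) p = (\<lambda>v. deriv h (\<xi> p) * (a \<bullet> fst v))"
  by (rule dird_eq[OF has_derivative_comp_inner[OF smooth_has_real_derivative[OF h]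
      has_derivative_fst[OF has_derivative_ident]]])

lemma d_fiber_function:
  assumes u: "smooth u"
  shows "\<D> (\<lambda>p. u (\<zeta> p)) p = (\<lambda>v. deriv u (\<zeta> p) * (b \<bullet> snd v))"
  by (rule dird_eq[OF has_derivative_comp_inner[OF smooth_has_real_derivative[OF u]
      has_derivative_snd[OF has_derivative_ident]]])

lemma Hess_base_function:
  assumes h: "smooth h"
  shows "Hess g (\<lambda>p. h (\<xi> p)) p v w =
     (deriv (deriv h) (\<xi> p) + 2 * (deriv \<phi> (\<xi> p) / \<phi> (\<xi> p)) * deriv h (\<xi> p))
       * ((a \<bullet> fst v) * (a \<bullet> fst w))
     - (deriv \<phi> (\<xi> p) / \<phi> (\<xi> p)) * deriv h (\<xi> p) * (J a \<bullet> a) * (J (fst v) \<bullet> fst w)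
     + deriv f (\<xi> p) * f (\<xi> p) * (\<phi> (\<xi> p))\<^sup>2 * deriv h (\<xi> p) * (J a \<bullet> a) / (\<tau> (\<zeta> p))\<^sup>2
       * (K (snd v) \<bullet> snd w)"
proof -
  have "((\<lambda>q. deriv h (\<xi> q) * (a \<bullet> fst w)) has_derivative
      (\<lambda>v. deriv (deriv h) (\<xi> p) * (a \<bullet> fst v) * (a \<bullet> fst w))) (at p)"
    by (intro has_derivative_mult_left has_derivative_comp_inner
        smooth_has_real_derivative smooth_deriv h has_derivative_fst has_derivative_ident)
  then show ?thesis
    unfolding Hess_def d_base_function[OF h] Chr_g
    by (simp add: dird_eq inner_diff_right J.inner_conf inner_commute[of a "J a"] base_rate_def mixed_coeff_def
        algebra_simps)
qed

text \<open>
  Unlike the Hessian of a function on the base, this one has mixed terms; they lie off the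
  diagonal blocks and so do not contribute to the Laplacian.
\<close>

lemma Hess_fiber_function:
  assumes u: "smooth u"
  shows "Hess g (\<lambda>p. u (\<zeta> p)) p v w =
     deriv (deriv u) (\<zeta> p) * ((b \<bullet> snd v) * (b \<bullet> snd w))
     - deriv u (\<zeta> p) * (warp_rate (\<xi> p) * ((a \<bullet> fst v) * (b \<bullet> snd w) + (a \<bullet> fst w) * (b \<bullet> snd v))
         + fiber_rate (\<zeta> p) * (2 * (b \<bullet> snd v) * (b \<bullet> snd w) - (K (snd v) \<bullet> snd w) * (K b \<bullet> b)))"
proof -
  have "((\<lambda>q. deriv u (\<zeta> q) * (b \<bullet> snd w)) has_derivative
      (\<lambda>v. deriv (deriv u) (\<zeta> p) * (b \<bullet> snd v) * (b \<bullet> snd w))) (at p)"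
    by (intro has_derivative_mult_left has_derivative_comp_inner
        smooth_has_real_derivative smooth_deriv u has_derivative_snd has_derivative_ident)
  then show ?thesis
    unfolding Hess_def d_fiber_function[OF u] Chr_g
    by (simp add: dird_eq inner_add_right K.inner_conf algebra_simps)
qed

lemma Laplacian_fiber_function:
  assumes u: "smooth u"
  shows "Laplacian g (\<lambda>p. u (\<zeta> p)) p = (\<tau> (\<zeta> p))\<^sup>2 / (f (\<xi> p))\<^sup>2 *
     ((deriv (deriv u) (\<zeta> p) - (real DIM('b) - 2) * (deriv \<tau> (\<zeta> p) / \<tau> (\<zeta> p)) * deriv u (\<zeta> p)) * (K b \<bullet> b))"
proof -
  let ?s = "\<xi> p" and ?t = "\<zeta> p"
  let ?c = "(\<tau> ?t)\<^sup>2 / (f ?s)\<^sup>2"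
  have sharp: "sharp g p (Hess g (\<lambda>p. u (\<zeta> p)) p v) =
     (- ((\<phi> ?s)\<^sup>2 * (deriv u ?t * warp_rate ?s * (b \<bullet> snd v))) *\<^sub>R J a,
      ?c *\<^sub>R ((deriv (deriv u) ?t * (b \<bullet> snd v)) *\<^sub>R K b
        - (deriv u ?t * warp_rate ?s * (a \<bullet> fst v)) *\<^sub>R K b
        - (deriv u ?t * fiber_rate ?t * 2 * (b \<bullet> snd v)) *\<^sub>R K b
        + (deriv u ?t * fiber_rate ?t * (K b \<bullet> b)) *\<^sub>R snd v))" for v
    unfolding Hess_fiber_function[OF u]
    by (rule sharp_g_eqI)
      (simp add: g_def J.J_scale J.J_minus K.J_add K.J_diff K.J_scale inner_simps divide_simps,
       simp add: algebra_simps)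
  have "Laplacian g (\<lambda>p. u (\<zeta> p)) p = ?c * (deriv (deriv u) ?t * (b \<bullet> K b)
      - deriv u ?t * fiber_rate ?t * 2 * (b \<bullet> K b) + deriv u ?t * fiber_rate ?t * (K b \<bullet> b) * DIM('b))"
    unfolding Laplacian_def trace_g_def tr_prod sharp
    by (simp add: tr_simps tr_zero)
  then show ?thesis
    by (simp add: fiber_rate_def inner_commute[of b "K b"] add_divide_distrib diff_divide_distrib algebra_simps)
qed

lemma grad_fiber_base_orthogonal:
  assumes h: "smooth h" and u: "smooth u"
  shows "g p (grad g (\<lambda>p. u (\<zeta> p)) p) (grad g (\<lambda>p. h (\<xi> p)) p) = 0"
proof -
  have "grad g (\<lambda>p. u (\<zeta> p)) p = (0, ((\<tau> (\<zeta> p))\<^sup>2 / (f (\<xi> p))\<^sup>2 * deriv u (\<zeta> p)) *\<^sub>R K b)"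
    unfolding grad_def d_fiber_function[OF u]
    by (rule sharp_g_eqI) (simp add: g_def K.J_scale)
  moreover have "grad g (\<lambda>p. h (\<xi> p)) p = (((\<phi> (\<xi> p))\<^sup>2 * deriv h (\<xi> p)) *\<^sub>R J a, 0)"
    unfolding grad_def d_base_function[OF h]
    by (rule sharp_g_eqI) (simp add: g_def J.J_scale)
  ultimately show ?thesis by (simp add: g_def)
qed

section \<open>The soliton equations\<close>

lemma GRHS_g_iff:
  fixes n m lam \<theta> :: real
  defines "n \<equiv> DIM('a)" and "m \<equiv> DIM('b)"
  assumes h: "smooth h" and u: "smooth u" and \<theta>: "\<theta> \<ge> 0"
    and a: "a \<noteq> 0" and b: "b \<noteq> 0" and dim: "DIM('a) \<ge> 2" "DIM('b) \<ge> 2"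
  shows "GRHS g (\<lambda>p. h (\<xi> p)) (\<lambda>p. u (\<zeta> p)) lam \<theta> \<longleftrightarrow>
    (\<forall>s. (n - 2) * (deriv (deriv \<phi>) s / \<phi> s) - m * (deriv (deriv f) s / f s)
             - 2 * m * (deriv \<phi> s / \<phi> s) * (deriv f s / f s)
             + deriv (deriv h) s + 2 * (deriv \<phi> s / \<phi> s) * deriv h s = 0) \<and>
    (\<forall>s. (deriv (deriv \<phi>) s / \<phi> s - (n - 1) * (deriv \<phi> s / \<phi> s)^2
             + m * (deriv \<phi> s / \<phi> s) * (deriv f s / f s)
             - (deriv \<phi> s / \<phi> s) * deriv h s) * (J a \<bullet> a) = lam / (\<phi> s)^2) \<and>
    (\<forall>s t. (deriv (deriv f) s * (\<phi> s)^2 * f s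
               - (n - 2) * deriv \<phi> s * \<phi> s * f s * deriv f s
               + (m - 1) * (deriv f s)^2 * (\<phi> s)^2
               - deriv f s * f s * (\<phi> s)^2 * deriv h s) * (J a \<bullet> a) + lam * (f s)^2
             = (\<tau> t)^2 * (deriv (deriv \<tau>) t / \<tau> t - (m - 1) * (deriv \<tau> t / \<tau> t)^2)
               * (K b \<bullet> b)) \<and>
    (\<forall>t. (m - 2) * (deriv (deriv \<tau>) t / \<tau> t) - \<theta> * (deriv u t)^2 = 0) \<and>
    (\<forall>t. ((\<tau> t)^2 * deriv (deriv u) t - (m - 2) * \<tau> t * deriv \<tau> t * deriv u t)
             * (K b \<bullet> b) = 0)"
    (is "?G \<longleftrightarrow> (\<forall>s. ?E1 s = 0) \<and> (\<forall>s. ?E2 s * (J a \<bullet> a) = lam / (\<phi> s)\<^sup>2)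
       \<and> (\<forall>s t. ?E3 s * (J a \<bullet> a) + lam * (f s)\<^sup>2 = (\<tau> t)\<^sup>2 * ?T t * (K b \<bullet> b))
       \<and> (\<forall>t. ?E4 t = 0) \<and> (\<forall>t. ?E5 t * (K b \<bullet> b) = 0)")
proof -
  let ?Q = "\<lambda>s. ?E2 s * (J a \<bullet> a) - lam / (\<phi> s)\<^sup>2"
  let ?S = "\<lambda>s t. ?T t * (K b \<bullet> b) - (?E3 s * (J a \<bullet> a) + lam * (f s)\<^sup>2) / (\<tau> t)\<^sup>2"
  \<comment> \<open>The defect of the soliton equation, one pair of terms for the base and one for the fiber.\<close>
  have tensor: "Ric g p v w + Hess g (\<lambda>p. h (\<xi> p)) p v w
        - \<theta> * (\<D> (\<lambda>p. u (\<zeta> p)) p v * \<D> (\<lambda>p. u (\<zeta> p)) p w) - lam * g p v w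
     = (?E1 (\<xi> p) * ((a \<bullet> fst v) * (a \<bullet> fst w)) + ?Q (\<xi> p) * (J (fst v) \<bullet> fst w))
      + (?E4 (\<zeta> p) * ((b \<bullet> snd v) * (b \<bullet> snd w)) + ?S (\<xi> p) (\<zeta> p) * (K (snd v) \<bullet> snd w))" for p v w
    unfolding Ric_g Hess_base_function[OF h] d_fiber_function[OF u] g_def
      n_def[symmetric] m_def[symmetric]
    by (simp add: algebra_simps power2_eq_square add_divide_distrib diff_divide_distrib)
  have laplace: "Laplacian g (\<lambda>p. u (\<zeta> p)) p
       - g p (grad g (\<lambda>p. u (\<zeta> p)) p) (grad g (\<lambda>p. h (\<xi> p)) p)
     = ?E5 (\<zeta> p) * (K b \<bullet> b) / (f (\<xi> p))\<^sup>2" for p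
    unfolding Laplacian_fiber_function[OF u] grad_fiber_base_orthogonal[OF h u] m_def[symmetric]
    by (simp add: field_simps power2_eq_square)
  have onto: "\<exists>p. \<xi> p = s \<and> \<zeta> p = t" for s t
    using a b by (intro exI[of _ "((s / (a \<bullet> a)) *\<^sub>R a, (t / (b \<bullet> b)) *\<^sub>R b)"]) simp
  have bl: "bounded_linear (fst :: 'a \<times> 'b \<Rightarrow> 'a)" "bounded_linear (snd :: 'a \<times> 'b \<Rightarrow> 'b)"
    by (rule bounded_linear_fst bounded_linear_snd)+
  have sm: "smooth (\<lambda>p. h (\<xi> p))" "smooth (\<lambda>p. u (\<zeta> p))"
    using smooth_comp_inner[OF h bl(1)] smooth_comp_inner[OF u bl(2)] by blast+
  have "?G \<longleftrightarrow> (\<forall>p v w. (?E1 (\<xi> p) * ((a \<bullet> fst v) * (a \<bullet> fst w)) + ?Q (\<xi> p) * (J (fst v) \<bullet> fst w))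
      + (?E4 (\<zeta> p) * ((b \<bullet> snd v) * (b \<bullet> snd w)) + ?S (\<xi> p) (\<zeta> p) * (K (snd v) \<bullet> snd w)) = 0)
    \<and> (\<forall>p. ?E5 (\<zeta> p) * (K b \<bullet> b) / (f (\<xi> p))\<^sup>2 = 0)"
    unfolding GRHS_def laplace tensor[symmetric]
    using semi_riemannian_g sm \<theta> by (simp del: split_paired_All)
  also have "\<dots> \<longleftrightarrow> (\<forall>s t. ?E1 s = 0 \<and> ?Q s = 0 \<and> ?E4 t = 0 \<and> ?S s t = 0) \<and> (\<forall>t. ?E5 t * (K b \<bullet> b) = 0)"
    (is "?L1 \<and> ?L2 \<longleftrightarrow> ?R1 \<and> ?R2")
  proof -
    have "?L1 \<longleftrightarrow> ?R1"
    proof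
      assume L: ?L1
      show ?R1
      proof (intro allI)
        fix s t
        obtain p where p: "\<xi> p = s" "\<zeta> p = t" using onto by blast
        note L' = spec[OF spec[OF spec[OF L, of p]], unfolded p]
        have "?E1 s = 0 \<and> ?Q s = 0"
          by (rule J.rank_two_form_eq_0[OF dim(1) a]) (use L'[of "(_, 0)" "(_, 0)"] in simp)
        moreover have "?E4 t = 0 \<and> ?S s t = 0"
          by (rule K.rank_two_form_eq_0[OF dim(2) b]) (use L'[of "(0, _)" "(0, _)"] in simp)
        ultimately show "?E1 s = 0 \<and> ?Q s = 0 \<and> ?E4 t = 0 \<and> ?S s t = 0" by blast
      qed
    next
      assume ?R1
      then show ?L1 by (simp only: mult_zero_left add_0_left simp_thms)
    qed
    moreover have "?L2 \<longleftrightarrow> ?R2"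
    proof
      assume L: ?L2
      show ?R2
      proof
        fix t
        obtain p where "\<zeta> p = t" using onto by blast
        then show "?E5 t * (K b \<bullet> b) = 0" using spec[OF L, of p] by simp
      qed
    next
      assume ?R2
      then show ?L2 by (simp only: div_0 simp_thms)
    qed
    ultimately show ?thesis by (simp only:)
  qed
  also have "(\<forall>s t. ?E1 s = 0 \<and> ?Q s = 0 \<and> ?E4 t = 0 \<and> ?S s t = 0) \<longleftrightarrow>
     (\<forall>s. ?E1 s = 0) \<and> (\<forall>s. ?E2 s * (J a \<bullet> a) = lam / (\<phi> s)\<^sup>2)
       \<and> (\<forall>s t. ?E3 s * (J a \<bullet> a) + lam * (f s)\<^sup>2 = (\<tau> t)\<^sup>2 * ?T t * (K b \<bullet> b))
       \<and> (\<forall>t. ?E4 t = 0)"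
  proof -
    have div_eq: "x * k - y / c = 0 \<longleftrightarrow> y = c * x * k" if "c \<noteq> 0" for x k y c :: real
      using that by (auto simp: field_simps)
    have "?S s t = 0 \<longleftrightarrow> ?E3 s * (J a \<bullet> a) + lam * (f s)\<^sup>2 = (\<tau> t)\<^sup>2 * ?T t * (K b \<bullet> b)" for s t
      by (rule div_eq) simp
    moreover have "?Q s = 0 \<longleftrightarrow> ?E2 s * (J a \<bullet> a) = lam / (\<phi> s)\<^sup>2" for s
      by (rule right_minus_eq)
    ultimately show ?thesis by (simp only:) blast
  qed
  finally show ?thesis by (simp only: conj_assoc)
qed

end

section \<open>Semi-Euclidean coordinates\<close>

lemma self_adjoint_involution_signs:
  assumes "signs \<epsilon>"
  shows "self_adjoint_involution (\<lambda>x :: real^'i. \<chi> i. \<epsilon> i * x $ i)"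
proof (rule self_adjoint_involution.intro)
  have sq: "\<epsilon> i * \<epsilon> i = 1" for i using assms by (auto simp: signs_def dest: spec[of _ i])
  show "linear (\<lambda>x :: real^'i. \<chi> i. \<epsilon> i * x $ i)"
    by (rule linearI) (auto simp: vec_eq_iff algebra_simps)
  show "(\<chi> i. \<epsilon> i * (\<chi> i. \<epsilon> i * x $ i) $ i) = x" for x :: "real^'i"
    by (simp add: vec_eq_iff mult.assoc[symmetric] sq)
  show "(\<chi> i. \<epsilon> i * x $ i) \<bullet> y = x \<bullet> (\<chi> i. \<epsilon> i * y $ i)" for x y :: "real^'i"
    by (simp add: inner_vec_def algebra_simps)
qed

lemma linform_eq_inner: "linform a x = a \<bullet> x"
  by (simp add: linform_def inner_vec_def)

lemma semi_euclidean_eq_inner: "semi_euclidean \<epsilon> p v w = (\<chi> i. \<epsilon> i * v $ i) \<bullet> w"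
  by (simp add: semi_euclidean_def inner_vec_def)

lemma sqnorm_eq_inner: "sqnorm \<epsilon> a = (\<chi> i. \<epsilon> i * a $ i) \<bullet> a"
  by (simp add: sqnorm_def inner_vec_def power2_eq_square algebra_simps)

theorem theorem1p10:
  fixes \<epsilon> :: "'n::finite \<Rightarrow> real" and \<epsilon>' :: "'m::finite \<Rightarrow> real"
    and \<alpha> :: "real^'n" and \<beta> :: "real^'m"
    and \<phi> f h \<tau> u :: "real \<Rightarrow> real"
    and lam \<theta> n m :: real
    and g :: "((real^'n) \<times> (real^'m)) metric"
    and H U :: "(real^'n) \<times> (real^'m) \<Rightarrow> real"
  assumes "signs \<epsilon>" and "signs \<epsilon>'"
    and "\<alpha> \<noteq> 0" and "\<beta> \<noteq> 0"
    and "smooth \<phi>" and "smooth f" and "smooth h" and "smooth \<tau>" and "smooth u"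
    and "\<forall>s. \<phi> s > 0" and "\<forall>s. f s > 0" and "\<forall>t. \<tau> t > 0"
    and "\<not> u constant_on UNIV"
    and "\<theta> \<ge> 0"
    and "CARD('n) \<ge> 2" and "CARD('m) \<ge> 2"
    and "n = real CARD('n)" and "m = real CARD('m)"
    and "g = warped
           (conformal (\<lambda>x. \<phi> (linform \<alpha> x)) (semi_euclidean \<epsilon>))
           (\<lambda>x. f (linform \<alpha> x))
           (conformal (\<lambda>y. \<tau> (linform \<beta> y)) (semi_euclidean \<epsilon>'))"
    and "H = (\<lambda>p. h (linform \<alpha> (fst p)))"
    and "U = (\<lambda>p. u (linform \<beta> (snd p)))"
  shows
    "(CARD('m) \<ge> 3 \<longrightarrow>
      (GRHS g H U lam \<theta> \<longleftrightarrow>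
        (\<forall>s. (n - 2) * (deriv (deriv \<phi>) s / \<phi> s) - m * (deriv (deriv f) s / f s)
             - 2 * m * (deriv \<phi> s / \<phi> s) * (deriv f s / f s)
             + deriv (deriv h) s + 2 * (deriv \<phi> s / \<phi> s) * deriv h s = 0) \<and>
        (\<forall>s. (deriv (deriv \<phi>) s / \<phi> s - (n - 1) * (deriv \<phi> s / \<phi> s)^2
             + m * (deriv \<phi> s / \<phi> s) * (deriv f s / f s)
             - (deriv \<phi> s / \<phi> s) * deriv h s) * sqnorm \<epsilon> \<alpha> = lam / (\<phi> s)^2) \<and>
        (\<forall>s t. (deriv (deriv f) s * (\<phi> s)^2 * f s
               - (n - 2) * deriv \<phi> s * \<phi> s * f s * deriv f s
               + (m - 1) * (deriv f s)^2 * (\<phi> s)^2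
               - deriv f s * f s * (\<phi> s)^2 * deriv h s) * sqnorm \<epsilon> \<alpha> + lam * (f s)^2
             = (deriv (deriv \<tau>) t / \<tau> t - (m - 1) * (deriv \<tau> t / \<tau> t)^2) * sqnorm \<epsilon>' \<beta>) \<and>
        (\<forall>t. (m - 2) * (deriv (deriv \<tau>) t / \<tau> t) - \<theta> * (deriv u t)^2 = 0) \<and>
        (\<forall>t. ((\<tau> t)^2 * deriv (deriv u) t - (m - 2) * \<tau> t * deriv \<tau> t * deriv u t)
             * sqnorm \<epsilon>' \<beta> = 0)))
     \<and>
     (GRHS g H U lam \<theta> \<longleftrightarrow>
        (\<forall>s. (n - 2) * (deriv (deriv \<phi>) s / \<phi> s) - m * (deriv (deriv f) s / f s)
             - 2 * m * (deriv \<phi> s / \<phi> s) * (deriv f s / f s)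
             + deriv (deriv h) s + 2 * (deriv \<phi> s / \<phi> s) * deriv h s = 0) \<and>
        (\<forall>s. (deriv (deriv \<phi>) s / \<phi> s - (n - 1) * (deriv \<phi> s / \<phi> s)^2
             + m * (deriv \<phi> s / \<phi> s) * (deriv f s / f s)
             - (deriv \<phi> s / \<phi> s) * deriv h s) * sqnorm \<epsilon> \<alpha> = lam / (\<phi> s)^2) \<and>
        (\<forall>s t. (deriv (deriv f) s * (\<phi> s)^2 * f s
               - (n - 2) * deriv \<phi> s * \<phi> s * f s * deriv f s
               + (m - 1) * (deriv f s)^2 * (\<phi> s)^2
               - deriv f s * f s * (\<phi> s)^2 * deriv h s) * sqnorm \<epsilon> \<alpha> + lam * (f s)^2
             = (\<tau> t)^2 * (deriv (deriv \<tau>) t / \<tau> t - (m - 1) * (deriv \<tau> t / \<tau> t)^2)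
               * sqnorm \<epsilon>' \<beta>) \<and>
        (\<forall>t. (m - 2) * (deriv (deriv \<tau>) t / \<tau> t) - \<theta> * (deriv u t)^2 = 0) \<and>
        (\<forall>t. ((\<tau> t)^2 * deriv (deriv u) t - (m - 2) * \<tau> t * deriv \<tau> t * deriv u t)
             * sqnorm \<epsilon>' \<beta> = 0))"
  (is "(_ \<longrightarrow> (_ \<longleftrightarrow> ?E1 \<and> ?E2 \<and> ?E3 \<and> ?E4 \<and> ?E5)) \<and> (_ \<longleftrightarrow> _ \<and> _ \<and> ?E3' \<and> _)")
proof -
  define J where "J = (\<lambda>x :: real^'n. \<chi> i. \<epsilon> i * x $ i)"
  define K where "K = (\<lambda>x :: real^'m. \<chi> i. \<epsilon>' i * x $ i)"
  interpret conformal_warp J K \<alpha> \<beta> \<phi> f \<tau>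
    unfolding J_def K_def conformal_warp_def conformal_warp_axioms_def
    using assms by (simp add: self_adjoint_involution_signs)
  have g: "g = conformal_warp.g J K \<alpha> \<beta> \<phi> f \<tau>"
    unfolding assms(19)
    by (intro ext) (simp add: g_def warped_def conformal_def linform_eq_inner
        semi_euclidean_eq_inner, simp add: J_def K_def)
  have norms: "J \<alpha> \<bullet> \<alpha> = sqnorm \<epsilon> \<alpha>" "K \<beta> \<bullet> \<beta> = sqnorm \<epsilon>' \<beta>"
    by (simp_all add: sqnorm_eq_inner J_def K_def)
  have HU: "H = (\<lambda>p. h (\<alpha> \<bullet> fst p))" "U = (\<lambda>p. u (\<beta> \<bullet> snd p))"
    unfolding assms(20,21) linform_eq_inner by (rule refl)+
  have nm: "real DIM(real^'n) = n" "real DIM(real^'m) = m"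
    by (simp_all add: assms(17,18))
  have dims: "2 \<le> DIM(real^'n)" "2 \<le> DIM(real^'m)"
    using assms(15,16) by simp_all
  note iff = GRHS_g_iff[OF assms(7,9,14,3,4) dims, of lam, unfolded norms nm,
      folded g HU]
  show ?thesis
  proof (rule conjI)
    show "GRHS g H U lam \<theta> \<longleftrightarrow> ?E1 \<and> ?E2 \<and> ?E3' \<and> ?E4 \<and> ?E5"
      by (rule iff)
    show "CARD('m) \<ge> 3 \<longrightarrow> (GRHS g H U lam \<theta> \<longleftrightarrow> ?E1 \<and> ?E2 \<and> ?E3 \<and> ?E4 \<and> ?E5)"
    proof
      assume m3: "CARD('m) \<ge> 3"
      \<comment> \<open>The fiber side of the third equation vanishes, with or without the factor \<open>\<tau>\<^sup>2\<close>.\<close>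
      have T0: "(deriv (deriv \<tau>) t / \<tau> t - (m - 1) * (deriv \<tau> t / \<tau> t)^2) * sqnorm \<epsilon>' \<beta> = 0"
        if E4: ?E4 and E5: ?E5 for t
      proof (cases "sqnorm \<epsilon>' \<beta> = 0")
        case False
        have m: "real (CARD('m) - 2) = m - 2" using m3 by (simp add: assms(18))
        have "deriv \<tau> s = 0" for s
          by (rule fiber_profile_constant[of \<tau> u "CARD('m) - 2" \<theta>])
            (use assms(8,9,12,14) m3 E4 E5 False in \<open>simp_all add: m\<close>)
        then have "deriv \<tau> = (\<lambda>_. 0)" by blast
        then show ?thesis by simp
      qed simp
      have "?E3 \<longleftrightarrow> ?E3'" if ?E4 ?E5
        by (simp only: mult.assoc T0[OF that] mult_zero_right)
      then show "GRHS g H U lam \<theta> \<longleftrightarrow> ?E1 \<and> ?E2 \<and> ?E3 \<and> ?E4 \<and> ?E5"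
        unfolding iff by blast
    qed
  qed
qed

end
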